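(* Let $$u(x)=u_0+\sum_{i=1}^\infty u_i\cos(ix),\qquad v(x)=\sum_{i=1}^\infty v_i\sin(ix)$$ with real coefficients, and assume that for some integer $n\ge 1$, some $s>1$ and some constants $C_u>0$, $C_v>0$, $$u_i\in\frac{C_u[-1,1]}{i^s}\quad\text{and}\quad v_i\in\frac{C_v[-1,1]}{i^s}\qquad\text{for } i>n.$$ Then $$(uv)(x)=\sum_{k=1}^\infty (uv)_k\sin(kx),$$ with $$(uv)_k=u_0v_k+\frac12\sum_{i=1}^\infty u_iv_{i+k}-\frac12\sum_{i=1}^\infty u_{i+k}v_i+\frac12\sum_{i=1}^{k-1}u_iv_{k-i}\quad(k\ge1),$$ and the following estimates hold. For $1\le k\le 2n$, $$(uv)_k\in u_0v_k+\frac12\left(\sum_{i=1}^n v_{i+k}u_i-\sum_{i=1}^n v_iu_{k+i}+\sum_{i=1}^{k-1}v_iu_{k-i}\right)+C_uC_v\frac{n^{1-2s}}{2s-1}[-1,1].$$ For $k>2n$, $$(uv)_k\in\frac{D[-1,1]}{k^s},\qquad D=|u_0|C_v+\frac12\left(\sum_{i=1}^n\big(C_u|v_i|+C_v|u_i|\big)\left(1+\left(\frac{2n+1}{2n+1-i}\right)^s\right)+C_uC_v(2+2^s)\frac{n^{1-s}}{s-1}\right).$$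
   Context: For real numbers $a,c$, the notation $a+c[-1,1]$ denotes the interval $\{a+c\theta:\theta\in[-1,1]\}$, and $\frac{C[-1,1]}{i^s}$ denotes $\left[-\frac{C}{i^s},\frac{C}{i^s}\right]$. *)

theory Defs
  imports Complex_Main
begin

(* The interval a + c[-1,1]. *)
definition pm_interval :: "real \<Rightarrow> real \<Rightarrow> real set" where
  "pm_interval a c = {a + c * \<theta> | \<theta>. \<theta> \<in> {-1..1}}"

(* Coefficient sequences are indexed by nat. All series start at index 1, hence the
   shift by Suc; the value at 0 of a sine coefficient sequence is never used. *)

definition cos_series :: "(nat \<Rightarrow> real) \<Rightarrow> real \<Rightarrow> real" where
  "cos_series u x = u 0 + (\<Sum>i. u (Suc i) * cos (real (Suc i) * x))"

definition sin_series :: "(nat \<Rightarrow> real) \<Rightarrow> real \<Rightarrow> real" where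
  "sin_series v x = (\<Sum>i. v (Suc i) * sin (real (Suc i) * x))"

definition prod_coeff :: "(nat \<Rightarrow> real) \<Rightarrow> (nat \<Rightarrow> real) \<Rightarrow> nat \<Rightarrow> real" where
  "prod_coeff u v k =
     u 0 * v k
     + 1/2 * (\<Sum>i. u (Suc i) * v (Suc i + k))
     - 1/2 * (\<Sum>i. u (Suc i + k) * v (Suc i))
     + 1/2 * (\<Sum>i=1..k-1. u i * v (k - i))"

definition decay_const ::
  "(nat \<Rightarrow> real) \<Rightarrow> (nat \<Rightarrow> real) \<Rightarrow> nat \<Rightarrow> real \<Rightarrow> real \<Rightarrow> real \<Rightarrow> real" where
  "decay_const u v n s C\<^sub>u C\<^sub>v =
     \<bar>u 0\<bar> * C\<^sub>v
     + 1/2 * ((\<Sum>i=1..n. (C\<^sub>u * \<bar>v i\<bar> + C\<^sub>v * \<bar>u i\<bar>)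
                  * (1 + ((2 * real n + 1) / (2 * real n + 1 - real i)) powr s))
              + C\<^sub>u * C\<^sub>v * (2 + 2 powr s) * (real n powr (1 - s) / (s - 1)))"

end

theory Submission
  imports Defs "HOL-Analysis.Convex" "HOL-Analysis.Summation_Tests" "HOL-Analysis.Infinite_Sum"
begin

text \<open>Both coefficient sequences are absolutely summable, so the product is an unconditional sum over
  pairs \<open>(i, j)\<close> of \<open>u\<^sub>i v\<^sub>j (sin ((i + j) x) + sin ((j - i) x)) / 2\<close>; regrouping it along \<open>i + j\<close>,
  \<open>j - i\<close> and \<open>i - j\<close> gives the coefficient formula. The estimates compare the tails with the
  integral of \<open>t powr (- r)\<close>; in the finite convolution for \<open>k > 2n\<close>, at most one of \<open>i\<close> and \<open>k - i\<close> is
  \<open>\<le> n\<close>, and when both exceed \<open>n\<close> convexity splits \<open>(i (k - i)) powr (- s)\<close> into two tails.\<close>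

section \<open>Integral comparison for tails of the series of \<open>i powr (- r)\<close>\<close>

text \<open>The mean value theorem for the antiderivative
  \<open>- (t powr (1 - r) / (r - 1))\<close> gives the right-hand side as
  \<open>z powr (- r)\<close> with \<open>z < x + 1\<close>, and this power is decreasing. It is the
  integral comparison in a form that telescopes.\<close>

lemma powr_telescope_step:
  fixes r x :: real
  assumes "r > 1" "x > 0"
  shows "(x + 1) powr (- r) \<le> x powr (1 - r) / (r - 1) - (x + 1) powr (1 - r) / (r - 1)"
proof -
  have "\<exists>z. x < z \<and> z < x + 1 \<and>
      - ((x + 1) powr (1 - r) / (r - 1)) - - (x powr (1 - r) / (r - 1)) = (x + 1 - x) * z powr (- r)"
  proof (rule MVT2)
    fix y :: real
    assume "x \<le> y"
    then have "((\<lambda>t. t powr (1 - r)) has_real_derivative (1 - r) * y powr (1 - r - 1)) (at y)"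
      using assms by (intro has_real_derivative_powr) auto
    then have "((\<lambda>t. - (t powr (1 - r) / (r - 1))) has_real_derivative
        - ((1 - r) * y powr (1 - r - 1) / (r - 1))) (at y)"
      by (intro DERIV_minus DERIV_cdivide)
    moreover have "- ((1 - r) * y powr (1 - r - 1) / (r - 1)) = y powr (- r)"
      using assms by (simp add: field_simps)
    ultimately show "((\<lambda>t. - (t powr (1 - r) / (r - 1))) has_real_derivative y powr (- r)) (at y)"
      by simp
  qed auto
  then obtain z where z: "x < z" "z < x + 1"
    and "x powr (1 - r) / (r - 1) - (x + 1) powr (1 - r) / (r - 1) = z powr (- r)"
    by auto
  moreover have "(x + 1) powr (- r) \<le> z powr (- r)"
    using z assms by (intro powr_mono2') auto
  ultimately show ?thesis by simp
qed

lemma sum_powr_tail_le: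
  fixes r :: real
  assumes "r > 1" "n \<ge> 1"
  shows "(\<Sum>i<N. real (Suc (i + n)) powr (- r)) \<le> real n powr (1 - r) / (r - 1)"
proof -
  have "(\<Sum>i<N. real (Suc (i + n)) powr (- r))
      \<le> (\<Sum>i<N. real (i + n) powr (1 - r) / (r - 1) - real (Suc i + n) powr (1 - r) / (r - 1))"
    using powr_telescope_step[OF assms(1), of "real (_ + n)"] assms(2)
    by (intro sum_mono) (simp add: add_ac)
  also have "\<dots> = real n powr (1 - r) / (r - 1) - real (N + n) powr (1 - r) / (r - 1)"
    by (subst sum_lessThan_telescope') simp
  also have "\<dots> \<le> real n powr (1 - r) / (r - 1)"
    using assms by simp
  finally show ?thesis .
qed

lemma summable_powr_tail:
  fixes r :: real
  assumes "r > 1"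
  shows "summable (\<lambda>i. real (Suc (i + n)) powr (- r))"
proof -
  have "summable (\<lambda>i. real i powr (- r))"
    using assms summable_real_powr_iff[of "- r"] by simp
  then show ?thesis
    using summable_ignore_initial_segment[of _ "Suc n"] by fastforce
qed

lemma suminf_powr_tail_le:
  fixes r :: real
  assumes "r > 1" "n \<ge> 1"
  shows "(\<Sum>i. real (Suc (i + n)) powr (- r)) \<le> real n powr (1 - r) / (r - 1)"
  using sum_powr_tail_le[OF assms] summable_powr_tail[OF assms(1)] by (rule suminf_le_const[rotated])

section \<open>Absolute summability and tails of shifted products\<close>

lemma abs_summable_Suc_of_decay:
  fixes f :: "nat \<Rightarrow> real"
  assumes "r > 1" and decay: "\<And>i. i > n \<Longrightarrow> \<bar>f i\<bar> \<le> C * real i powr (- r)"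
  shows "summable (\<lambda>i. \<bar>f (Suc i)\<bar>)"
proof (rule summable_comparison_test')
  show "summable (\<lambda>i. C * real (Suc i) powr (- r))"
    using summable_powr_tail[OF assms(1), of 0] by (intro summable_mult) simp
  show "norm \<bar>f (Suc i)\<bar> \<le> C * real (Suc i) powr (- r)" if "i \<ge> n" for i
    using decay[of "Suc i"] that by simp
qed

text \<open>Terms of a summable sequence are bounded, so the shifted factor \<open>g\<close> costs
  only a constant.\<close>

lemma summable_abs_mult_shift:
  fixes f g :: "nat \<Rightarrow> real"
  assumes f: "summable (\<lambda>i. \<bar>f i\<bar>)" and g: "summable (\<lambda>i. \<bar>g i\<bar>)"
  shows "summable (\<lambda>i. \<bar>f i * g (i + k)\<bar>)"
proof -
  obtain K where K: "\<bar>g i\<bar> \<le> K" for i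
    using summable_imp_Bseq[OF g] by (auto simp: Bseq_def)
  show ?thesis
  proof (rule summable_comparison_test')
    show "summable (\<lambda>i. \<bar>f i\<bar> * K)" using f by (rule summable_mult2)
    show "norm \<bar>f i * g (i + k)\<bar> \<le> \<bar>f i\<bar> * K" if "i \<ge> 0" for i
      using K[of "i + k"] by (simp add: abs_mult mult_left_mono)
  qed
qed

text \<open>The parameters \<open>B\<close> and \<open>r\<close> leave open what
  \<open>i + k\<close> is compared with: \<open>i + k \<ge> i\<close> gives \<open>B = 1\<close> and
  \<open>r = 2 * s\<close> for the low coefficients, while \<open>i + k \<ge> k\<close> gives
  \<open>B = k powr (- s)\<close> and \<open>r = s\<close> for the high ones.\<close>

lemma shifted_product_tail_le:
  fixes f g :: "nat \<Rightarrow> real"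
  assumes "s > 1" "r > 1" "n \<ge> 1" "Cf \<ge> 0" "Cg \<ge> 0"
    and f: "\<And>i. i > n \<Longrightarrow> \<bar>f i\<bar> \<le> Cf * real i powr (- s)"
    and g: "\<And>i. i > n \<Longrightarrow> \<bar>g i\<bar> \<le> Cg * real i powr (- s)"
    and B: "\<And>i. i > n \<Longrightarrow> real i powr (- s) * real (i + k) powr (- s) \<le> B * real i powr (- r)"
    and "B \<ge> 0"
  shows "\<bar>(\<Sum>i. f (Suc i) * g (Suc i + k)) - (\<Sum>i=1..n. f i * g (i + k))\<bar>
           \<le> Cf * Cg * B * (real n powr (1 - r) / (r - 1))"
proof -
  let ?h = "\<lambda>i. f (Suc i) * g (Suc i + k)"
  have abs_sum: "summable (\<lambda>i. \<bar>?h i\<bar>)"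
    using summable_abs_mult_shift[of "\<lambda>i. f (Suc i)" "\<lambda>i. g (Suc i)" k]
      abs_summable_Suc_of_decay[OF assms(1) f] abs_summable_Suc_of_decay[OF assms(1) g] by simp
  have abs_tail: "summable (\<lambda>i. \<bar>?h (i + n)\<bar>)"
    using summable_ignore_initial_segment[OF abs_sum] .
  have "(\<Sum>i=1..n. f i * g (i + k)) = (\<Sum>i<n. ?h i)"
    by (rule sum.reindex_bij_witness[of _ Suc "\<lambda>i. i - 1"]) auto
  \<comment> \<open>The first \<open>n\<close> terms of the series are exactly the finite sum, so
    the difference is the tail alone.\<close>
  moreover have "suminf ?h = (\<Sum>i. ?h (i + n)) + (\<Sum>i<n. ?h i)"
    using suminf_split_initial_segment[OF summable_rabs_cancel[OF abs_sum]] .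
  ultimately have "\<bar>suminf ?h - (\<Sum>i=1..n. f i * g (i + k))\<bar> = \<bar>\<Sum>i. ?h (i + n)\<bar>"
    by simp
  also have "\<dots> \<le> (\<Sum>i. \<bar>?h (i + n)\<bar>)"
    by (rule summable_rabs[OF abs_tail])
  also have "\<dots> \<le> (\<Sum>i. Cf * Cg * B * real (Suc (i + n)) powr (- r))"
  proof (rule suminf_le[OF _ abs_tail])
    show "summable (\<lambda>i. Cf * Cg * B * real (Suc (i + n)) powr (- r))"
      using summable_powr_tail[OF assms(2)] by (rule summable_mult)
    show "\<bar>?h (i + n)\<bar> \<le> Cf * Cg * B * real (Suc (i + n)) powr (- r)" for i
    proof -
      let ?i = "Suc (i + n)"
      have "\<bar>?h (i + n)\<bar> \<le> (Cf * real ?i powr (- s)) * (Cg * real (?i + k) powr (- s))"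
        unfolding abs_mult using f[of ?i] g[of "?i + k"] assms(4)
        by (intro mult_mono) auto
      also have "\<dots> = Cf * Cg * (real ?i powr (- s) * real (?i + k) powr (- s))"
        by (simp add: mult_ac)
      also have "\<dots> \<le> Cf * Cg * (B * real ?i powr (- r))"
        using B[of ?i] assms(4,5) by (intro mult_left_mono) auto
      finally show ?thesis by (simp add: mult_ac)
    qed
  qed
  also have "\<dots> = Cf * Cg * B * (\<Sum>i. real (Suc (i + n)) powr (- r))"
    using summable_powr_tail[OF assms(2)] by (rule suminf_mult)
  also have "\<dots> \<le> Cf * Cg * B * (real n powr (1 - r) / (r - 1))"
    using suminf_powr_tail_le[OF assms(2,3)] assms(4,5,9) by (intro mult_left_mono) auto
  finally show ?thesis .
qed

section \<open>The finite convolution for \<open>k > 2n\<close>\<close>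

text \<open>Convexity of \<open>t \<mapsto> t powr s\<close> at \<open>1/x\<close> and \<open>1/y\<close>, whose sum is \<open>(x + y)/(x y)\<close>.\<close>
lemma powr_minus_mult_le:
  fixes s x y :: real
  assumes "s \<ge> 1" "x > 0" "y > 0"
  shows "x powr (- s) * y powr (- s)
      \<le> 2 powr s / 2 * (x + y) powr (- s) * (x powr (- s) + y powr (- s))"
proof -
  have eq: "(1 - 1/2) *\<^sub>R (1/x) + (1/2) *\<^sub>R (1/y) = (x + y) / (2 * (x * y))"
    using assms by (simp add: field_simps)
  have "((x + y) / (2 * (x * y))) powr s \<le> (1 - 1/2) * (1/x) powr s + (1/2) * (1/y) powr s"
    using convex_onD[OF powr_convex[OF assms(1)], of "1/2" "1/x" "1/y"] assms
    unfolding eq by simp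
  then have "((x + y) / (2 * (x * y))) powr s \<le> (x powr (- s) + y powr (- s)) / 2"
    using assms by (simp add: powr_divide powr_minus field_simps)
  moreover
  \<comment> \<open>The power of the midpoint of \<open>1/x\<close> and \<open>1/y\<close> is the
    product to be bounded, up to a factor that is then multiplied across.\<close>
  have "((x + y) / (2 * (x * y))) powr s
      = x powr (- s) * y powr (- s) / (2 powr s * (x + y) powr (- s))"
    using assms by (simp add: powr_divide powr_mult powr_minus field_simps)
  then have "x powr (- s) * y powr (- s)
      = 2 powr s * (x + y) powr (- s) * ((x + y) / (2 * (x * y))) powr s"
    using assms by simp
  ultimately show ?thesis
    using mult_left_mono[of "((x + y) / (2 * (x * y))) powr s" "(x powr (- s) + y powr (- s)) / 2"
        "2 powr s * (x + y) powr (- s)"] by simp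
qed

text \<open>Both indices \<open>i\<close> and \<open>k - i\<close> exceed \<open>n\<close> and add
  up to \<open>k\<close>, so \<open>powr_minus_mult_le\<close> pulls out
  \<open>k powr (- s)\<close>. The two remaining sums agree by the reflection
  \<open>i \<mapsto> k - i\<close>, which absorbs the factor \<open>1/2\<close>.\<close>

lemma middle_convolution_le:
  fixes f g :: "nat \<Rightarrow> real"
  assumes "s > 1" "n \<ge> 1" "Cf \<ge> 0" "Cg \<ge> 0"
    and f: "\<And>i. i > n \<Longrightarrow> \<bar>f i\<bar> \<le> Cf * real i powr (- s)"
    and g: "\<And>i. i > n \<Longrightarrow> \<bar>g i\<bar> \<le> Cg * real i powr (- s)"
  shows "(\<Sum>i\<in>{n<..<k-n}. \<bar>f i * g (k - i)\<bar>)
      \<le> Cf * Cg * 2 powr s * (real n powr (1 - s) / (s - 1)) * real k powr (- s)"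
proof -
  let ?S = "\<Sum>i\<in>{n<..<k-n}. real i powr (- s)"
  have "(\<Sum>i\<in>{n<..<k-n}. \<bar>f i * g (k - i)\<bar>)
      \<le> (\<Sum>i\<in>{n<..<k-n}. Cf * Cg * (2 powr s / 2 * real k powr (- s)
            * (real i powr (- s) + real (k - i) powr (- s))))"
  proof (rule sum_mono)
    fix i assume i: "i \<in> {n<..<k-n}"
    have "\<bar>f i * g (k - i)\<bar> \<le> (Cf * real i powr (- s)) * (Cg * real (k - i) powr (- s))"
      unfolding abs_mult using i f[of i] g[of "k - i"] assms(3) by (intro mult_mono) auto
    also have "\<dots> = Cf * Cg * (real i powr (- s) * real (k - i) powr (- s))"
      by (simp add: mult_ac)
    also have "\<dots> \<le> Cf * Cg * (2 powr s / 2 * real k powr (- s)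
            * (real i powr (- s) + real (k - i) powr (- s)))"
      using powr_minus_mult_le[of s "real i" "real (k - i)"] i assms
      by (intro mult_left_mono) (auto simp: of_nat_diff)
    finally show "\<bar>f i * g (k - i)\<bar> \<le> Cf * Cg * (2 powr s / 2 * real k powr (- s)
            * (real i powr (- s) + real (k - i) powr (- s)))" .
  qed
  also have "\<dots> = Cf * Cg * (2 powr s / 2 * real k powr (- s)
      * (?S + (\<Sum>i\<in>{n<..<k-n}. real (k - i) powr (- s))))"
    by (simp only: flip: sum_distrib_left sum.distrib)
  also have "(\<Sum>i\<in>{n<..<k-n}. real (k - i) powr (- s)) = ?S"
    by (rule sum.reindex_bij_witness[of _ "\<lambda>i. k - i" "\<lambda>i. k - i"]) auto
  also have "Cf * Cg * (2 powr s / 2 * real k powr (- s) * (?S + ?S))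
      = Cf * Cg * (2 powr s * real k powr (- s)) * ?S"
    by simp
  also have "\<dots> \<le> Cf * Cg * (2 powr s * real k powr (- s)) * (real n powr (1 - s) / (s - 1))"
  proof (rule mult_left_mono)
    \<comment> \<open>The range is enlarged to the \<open>k\<close> consecutive indices after
      \<open>n\<close>, the shape of the finite tail bound.\<close>
    have "?S \<le> (\<Sum>i\<in>{n<..<k+n+1}. real i powr (- s))"
      by (rule sum_mono2) auto
    also have "\<dots> = (\<Sum>i<k. real (Suc (i + n)) powr (- s))"
      by (rule sum.reindex_bij_witness[of _ "\<lambda>i. Suc (i + n)" "\<lambda>i. i - Suc n"]) auto
    also have "\<dots> \<le> real n powr (1 - s) / (s - 1)"
      using assms by (intro sum_powr_tail_le)
    finally show "?S \<le> real n powr (1 - s) / (s - 1)" .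
  qed (use assms in auto)
  finally show ?thesis by (simp add: mult_ac)
qed

text \<open>The ratio \<open>k / (k - i)\<close> does not increase with \<open>k\<close>, so over
  \<open>k > 2n\<close> its worst case is \<open>k = 2n + 1\<close>; this is the source of the
  weight in \<open>decay_const\<close>. The index \<open>k - i\<close> exceeds \<open>n\<close>, so
  the decay of \<open>g\<close> applies to it.\<close>

lemma low_times_high_le:
  fixes g :: "nat \<Rightarrow> real"
  assumes "s > 1" "C \<ge> 0" "i \<le> n" "2 * n < k"
    and g: "\<And>i. i > n \<Longrightarrow> \<bar>g i\<bar> \<le> C * real i powr (- s)"
  shows "\<bar>g (k - i)\<bar> \<le> C * ((2 * real n + 1) / (2 * real n + 1 - real i)) powr s * real k powr (- s)"
proof -
  have pos: "real k > 0" "real (k - i) > 0" "2 * real n + 1 - real i > 0" "real k - real i > 0"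
    using assms by auto
  have "real k / real (k - i) \<le> (2 * real n + 1) / (2 * real n + 1 - real i)"
  proof -
    \<comment> \<open>After cross-multiplication the common term \<open>k * (2n + 1)\<close> cancels
      and only this comparison is left.\<close>
    have "(2 * real n + 1) * real i \<le> real k * real i"
      using assms(4) by (intro mult_right_mono) auto
    then show ?thesis
      using pos assms(3,4) by (simp add: of_nat_diff divide_simps) (simp add: algebra_simps)
  qed
  then have "(real k / real (k - i)) powr s \<le> ((2 * real n + 1) / (2 * real n + 1 - real i)) powr s"
    using assms(1) by (intro powr_mono2) auto
  moreover have "real (k - i) powr (- s) = (real k / real (k - i)) powr s * real k powr (- s)"
    using pos by (simp add: powr_divide powr_minus field_simps del: of_nat_diff)
  ultimately have "real (k - i) powr (- s)
      \<le> ((2 * real n + 1) / (2 * real n + 1 - real i)) powr s * real k powr (- s)"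
    by (simp add: mult_right_mono)
  then have "C * real (k - i) powr (- s)
      \<le> C * (((2 * real n + 1) / (2 * real n + 1 - real i)) powr s * real k powr (- s))"
    using assms(2) by (rule mult_left_mono)
  moreover have "\<bar>g (k - i)\<bar> \<le> C * real (k - i) powr (- s)"
    using assms by (intro g) auto
  ultimately show ?thesis by (simp add: mult.assoc)
qed

lemma convolution_le:
  fixes f g :: "nat \<Rightarrow> real"
  assumes "s > 1" "n \<ge> 1" "Cf \<ge> 0" "Cg \<ge> 0" "2 * n < k"
    and f: "\<And>i. i > n \<Longrightarrow> \<bar>f i\<bar> \<le> Cf * real i powr (- s)"
    and g: "\<And>i. i > n \<Longrightarrow> \<bar>g i\<bar> \<le> Cg * real i powr (- s)"
  shows "\<bar>\<Sum>i=1..k-1. f i * g (k - i)\<bar>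
      \<le> ((\<Sum>i=1..n. (Cf * \<bar>g i\<bar> + Cg * \<bar>f i\<bar>) * ((2 * real n + 1) / (2 * real n + 1 - real i)) powr s)
          + Cf * Cg * 2 powr s * (real n powr (1 - s) / (s - 1))) * real k powr (- s)"
proof -
  let ?w = "\<lambda>i. ((2 * real n + 1) / (2 * real n + 1 - real i)) powr s"
  let ?K = "real k powr (- s)"
  let ?t = "\<lambda>i. \<bar>f i * g (k - i)\<bar>"
  \<comment> \<open>Since \<open>n < k - n\<close>, the three blocks are disjoint: \<open>i\<close>
    is small, neither index is small, \<open>k - i\<close> is small.\<close>
  have "{1..k-1} = {1..n} \<union> ({n<..<k-n} \<union> {k-n..k-1})"
    using assms(5) by auto
  then have "sum ?t {1..k-1} = sum ?t ({1..n} \<union> ({n<..<k-n} \<union> {k-n..k-1}))" by simp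
  also have "\<dots> = sum ?t {1..n} + (sum ?t {n<..<k-n} + sum ?t {k-n..k-1})"
    using assms(5) by (subst sum.union_disjoint; (subst sum.union_disjoint)?) auto
  finally have split: "sum ?t {1..k-1} = sum ?t {1..n} + (sum ?t {n<..<k-n} + sum ?t {k-n..k-1})" .
  have low: "sum ?t {1..n} \<le> (\<Sum>i=1..n. Cg * \<bar>f i\<bar> * ?w i * ?K)"
  proof (rule sum_mono)
    fix i assume "i \<in> {1..n}"
    then have "\<bar>g (k - i)\<bar> \<le> Cg * ?w i * ?K"
      by (intro low_times_high_le[OF assms(1,4) _ assms(5) g]) auto
    then have "\<bar>f i\<bar> * \<bar>g (k - i)\<bar> \<le> \<bar>f i\<bar> * (Cg * ?w i * ?K)"
      by (rule mult_left_mono) simp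
    then show "?t i \<le> Cg * \<bar>f i\<bar> * ?w i * ?K" by (simp add: abs_mult mult_ac)
  qed
  \<comment> \<open>Reflection turns the last block into the first one with \<open>f\<close> and
    \<open>g\<close> exchanged.\<close>
  have "sum ?t {k-n..k-1} = (\<Sum>i=1..n. \<bar>f (k - i) * g i\<bar>)"
    using assms(5) by (intro sum.reindex_bij_witness[of _ "\<lambda>i. k - i" "\<lambda>i. k - i"]) auto
  also have "\<dots> \<le> (\<Sum>i=1..n. Cf * \<bar>g i\<bar> * ?w i * ?K)"
  proof (rule sum_mono)
    fix i assume "i \<in> {1..n}"
    then have "\<bar>f (k - i)\<bar> \<le> Cf * ?w i * ?K"
      by (intro low_times_high_le[OF assms(1,3) _ assms(5) f]) auto
    then have "\<bar>g i\<bar> * \<bar>f (k - i)\<bar> \<le> \<bar>g i\<bar> * (Cf * ?w i * ?K)"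
      by (rule mult_left_mono) simp
    then show "\<bar>f (k - i) * g i\<bar> \<le> Cf * \<bar>g i\<bar> * ?w i * ?K" by (simp add: abs_mult mult_ac)
  qed
  finally have high: "sum ?t {k-n..k-1} \<le> (\<Sum>i=1..n. Cf * \<bar>g i\<bar> * ?w i * ?K)" .
  have "\<bar>\<Sum>i=1..k-1. f i * g (k - i)\<bar> \<le> sum ?t {1..k-1}"
    by (rule sum_abs)
  also have "\<dots> \<le> (\<Sum>i=1..n. Cg * \<bar>f i\<bar> * ?w i * ?K)
      + (Cf * Cg * 2 powr s * (real n powr (1 - s) / (s - 1)) * ?K
         + (\<Sum>i=1..n. Cf * \<bar>g i\<bar> * ?w i * ?K))"
    unfolding split using low high middle_convolution_le[OF assms(1-4) f g, of k]
    by (intro add_mono) auto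
  also have "\<dots> = ((\<Sum>i=1..n. (Cf * \<bar>g i\<bar> + Cg * \<bar>f i\<bar>) * ?w i)
          + Cf * Cg * 2 powr s * (real n powr (1 - s) / (s - 1))) * ?K"
    by (simp only: distrib_right sum.distrib sum_distrib_right add_ac)
  finally show ?thesis .
qed

section \<open>The coefficient estimates\<close>

text \<open>Every index \<open>i + k\<close> is at least \<open>k > n\<close>, so the decay of
  \<open>g\<close> extracts \<open>k powr (- s)\<close> from each term. The first \<open>n\<close>
  values of \<open>f\<close> are kept, and its tail is bounded by the integral.\<close>

lemma shifted_product_le:
  fixes f g :: "nat \<Rightarrow> real"
  assumes "s > 1" "n \<ge> 1" "Cf \<ge> 0" "Cg \<ge> 0" "n < k"
    and f: "\<And>i. i > n \<Longrightarrow> \<bar>f i\<bar> \<le> Cf * real i powr (- s)"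
    and g: "\<And>i. i > n \<Longrightarrow> \<bar>g i\<bar> \<le> Cg * real i powr (- s)"
  shows "\<bar>\<Sum>i. f (Suc i) * g (Suc i + k)\<bar>
      \<le> ((\<Sum>i=1..n. Cg * \<bar>f i\<bar>) + Cf * Cg * (real n powr (1 - s) / (s - 1))) * real k powr (- s)"
proof -
  have shift: "real (i + k) powr (- s) \<le> real k powr (- s)" for i
    using assms by (intro powr_mono2') auto
  have "\<bar>(\<Sum>i. f (Suc i) * g (Suc i + k)) - (\<Sum>i=1..n. f i * g (i + k))\<bar>
      \<le> Cf * Cg * real k powr (- s) * (real n powr (1 - s) / (s - 1))"
  proof (rule shifted_product_tail_le[OF assms(1) assms(1-4) f g])
    show "real i powr (- s) * real (i + k) powr (- s) \<le> real k powr (- s) * real i powr (- s)" for i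
      using mult_left_mono[OF shift[of i], of "real i powr (- s)"] by (simp add: mult.commute)
  qed auto
  moreover have "\<bar>\<Sum>i=1..n. f i * g (i + k)\<bar> \<le> (\<Sum>i=1..n. Cg * \<bar>f i\<bar> * real k powr (- s))"
  proof (rule order.trans[OF sum_abs sum_mono])
    fix i
    have "\<bar>g (i + k)\<bar> \<le> Cg * real k powr (- s)"
      using g[of "i + k"] mult_left_mono[OF shift[of i] assms(4)] assms(5) by simp
    then have "\<bar>f i\<bar> * \<bar>g (i + k)\<bar> \<le> \<bar>f i\<bar> * (Cg * real k powr (- s))"
      by (rule mult_left_mono) simp
    then show "\<bar>f i * g (i + k)\<bar> \<le> Cg * \<bar>f i\<bar> * real k powr (- s)"
      by (simp add: abs_mult mult_ac)
  qed
  ultimately have "\<bar>\<Sum>i. f (Suc i) * g (Suc i + k)\<bar>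
      \<le> (\<Sum>i=1..n. Cg * \<bar>f i\<bar> * real k powr (- s))
         + Cf * Cg * real k powr (- s) * (real n powr (1 - s) / (s - 1))"
    by linarith
  also have "\<dots> = ((\<Sum>i=1..n. Cg * \<bar>f i\<bar>)
      + Cf * Cg * (real n powr (1 - s) / (s - 1))) * real k powr (- s)"
    unfolding distrib_right sum_distrib_right by (simp only: mult_ac)
  finally show ?thesis .
qed

text \<open>Only the tails of the two infinite series are estimated. Each has the same bound, and
  the two factors \<open>1/2\<close> in \<open>prod_coeff\<close> add up to one.\<close>

lemma prod_coeff_low:
  assumes "n \<ge> 1" "s > 1" "C\<^sub>u > 0" "C\<^sub>v > 0"
    and u: "\<And>i. i > n \<Longrightarrow> \<bar>u i\<bar> \<le> C\<^sub>u * real i powr (- s)"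
    and v: "\<And>i. i > n \<Longrightarrow> \<bar>v i\<bar> \<le> C\<^sub>v * real i powr (- s)"
  shows "\<bar>prod_coeff u v k
      - (u 0 * v k + 1/2 * ((\<Sum>i=1..n. v (i + k) * u i) - (\<Sum>i=1..n. v i * u (k + i))
                                + (\<Sum>i=1..k-1. v i * u (k - i))))\<bar>
      \<le> C\<^sub>u * C\<^sub>v * (real n powr (1 - 2 * s) / (2 * s - 1))"
proof -
  let ?E = "C\<^sub>u * C\<^sub>v * (real n powr (1 - 2 * s) / (2 * s - 1))"
  have tail: "\<bar>(\<Sum>i. f (Suc i) * g (Suc i + k)) - (\<Sum>i=1..n. f i * g (i + k))\<bar>
      \<le> C * C' * 1 * (real n powr (1 - 2 * s) / (2 * s - 1))"
    if "C > 0" "C' > 0" "\<And>i. i > n \<Longrightarrow> \<bar>f i\<bar> \<le> C * real i powr (- s)"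
      "\<And>i. i > n \<Longrightarrow> \<bar>g i\<bar> \<le> C' * real i powr (- s)" for f g C C'
  proof (rule shifted_product_tail_le[OF assms(2) _ assms(1) _ _ that(3,4)])
    fix i assume "i > n"
    then have "real i powr (- s) * real (i + k) powr (- s) \<le> real i powr (- s) * real i powr (- s)"
      using assms(2) by (intro mult_left_mono powr_mono2') auto
    then show "real i powr (- s) * real (i + k) powr (- s) \<le> 1 * real i powr (- (2 * s))"
      by (simp flip: powr_add)
  qed (use assms(2) that in auto)
  have "\<bar>(\<Sum>i. u (Suc i) * v (Suc i + k)) - (\<Sum>i=1..n. v (i + k) * u i)\<bar> \<le> ?E"
    using tail[OF assms(3,4) u v] by (simp add: mult_ac)
  moreover have "\<bar>(\<Sum>i. u (Suc i + k) * v (Suc i)) - (\<Sum>i=1..n. v i * u (k + i))\<bar> \<le> ?E"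
    using tail[OF assms(4,3) v u] by (simp add: mult_ac add.commute[of k])
  \<comment> \<open>Reflection reconciles the order of factors in \<open>prod_coeff\<close> with
    that in the estimate.\<close>
  moreover have "(\<Sum>i=1..k-1. u i * v (k - i)) = (\<Sum>i=1..k-1. v i * u (k - i))"
    by (rule sum.reindex_bij_witness[of _ "\<lambda>i. k - i" "\<lambda>i. k - i"]) auto
  ultimately show ?thesis
    unfolding prod_coeff_def by (simp only: abs_le_iff) (simp add: algebra_simps)
qed

text \<open>The two shifted series contribute the \<open>1\<close> in the weights and the
  \<open>2\<close> in \<open>2 + 2 powr s\<close>; the convolution contributes the ratio weights and
  the \<open>2 powr s\<close>.\<close>

lemma prod_coeff_high:
  assumes "n \<ge> 1" "s > 1" "C\<^sub>u > 0" "C\<^sub>v > 0" "2 * n < k"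
    and u: "\<And>i. i > n \<Longrightarrow> \<bar>u i\<bar> \<le> C\<^sub>u * real i powr (- s)"
    and v: "\<And>i. i > n \<Longrightarrow> \<bar>v i\<bar> \<le> C\<^sub>v * real i powr (- s)"
  shows "\<bar>prod_coeff u v k\<bar> \<le> decay_const u v n s C\<^sub>u C\<^sub>v * real k powr (- s)"
proof -
  let ?K = "real k powr (- s)"
  let ?T = "real n powr (1 - s) / (s - 1)"
  let ?w = "\<lambda>i. ((2 * real n + 1) / (2 * real n + 1 - real i)) powr s"
  let ?A = "\<Sum>i. u (Suc i) * v (Suc i + k)"
  let ?B = "\<Sum>i. u (Suc i + k) * v (Suc i)"
  let ?C = "\<Sum>i=1..k-1. u i * v (k - i)"
  have nk: "n < k" using assms(5) by simp
  have C0: "C\<^sub>u \<ge> 0" "C\<^sub>v \<ge> 0" using assms by auto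
  have zero: "\<bar>u 0 * v k\<bar> \<le> \<bar>u 0\<bar> * C\<^sub>v * ?K"
    unfolding abs_mult mult.assoc by (intro mult_left_mono v nk) auto
  have A: "\<bar>?A\<bar> \<le> ((\<Sum>i=1..n. C\<^sub>v * \<bar>u i\<bar>) + C\<^sub>u * C\<^sub>v * ?T) * ?K"
    by (rule shifted_product_le[OF assms(2,1) C0 nk u v])
  have B: "\<bar>?B\<bar> \<le> ((\<Sum>i=1..n. C\<^sub>u * \<bar>v i\<bar>) + C\<^sub>u * C\<^sub>v * ?T) * ?K"
    using shifted_product_le[OF assms(2,1) C0(2,1) nk v u] by (simp add: mult.commute[of "v _"] mult.commute[of C\<^sub>v])
  have C: "\<bar>?C\<bar> \<le> ((\<Sum>i=1..n. (C\<^sub>u * \<bar>v i\<bar> + C\<^sub>v * \<bar>u i\<bar>) * ?w i) + C\<^sub>u * C\<^sub>v * 2 powr s * ?T) * ?K"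
    by (rule convolution_le[OF assms(2,1) C0 assms(5) u v])
  have "\<bar>prod_coeff u v k\<bar> \<le> \<bar>u 0 * v k\<bar> + 1/2 * (\<bar>?A\<bar> + \<bar>?B\<bar> + \<bar>?C\<bar>)"
  proof -
    have "\<bar>a + 1/2 * b - 1/2 * c + 1/2 * d\<bar> \<le> \<bar>a\<bar> + 1/2 * (\<bar>b\<bar> + \<bar>c\<bar> + \<bar>d\<bar>)" for a b c d :: real
      by argo
    then show ?thesis unfolding prod_coeff_def .
  qed
  also have "\<dots> \<le> \<bar>u 0\<bar> * C\<^sub>v * ?K + 1/2 * (((\<Sum>i=1..n. C\<^sub>v * \<bar>u i\<bar>) + C\<^sub>u * C\<^sub>v * ?T) * ?K
      + ((\<Sum>i=1..n. C\<^sub>u * \<bar>v i\<bar>) + C\<^sub>u * C\<^sub>v * ?T) * ?K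
      + ((\<Sum>i=1..n. (C\<^sub>u * \<bar>v i\<bar> + C\<^sub>v * \<bar>u i\<bar>) * ?w i) + C\<^sub>u * C\<^sub>v * 2 powr s * ?T) * ?K)"
    by (intro add_mono mult_left_mono zero A B C) simp
  also have "\<dots> = decay_const u v n s C\<^sub>u C\<^sub>v * ?K"
  proof -
    have "(\<Sum>i=1..n. (C\<^sub>u * \<bar>v i\<bar> + C\<^sub>v * \<bar>u i\<bar>) * (1 + ?w i))
        = (\<Sum>i=1..n. C\<^sub>u * \<bar>v i\<bar>) + (\<Sum>i=1..n. C\<^sub>v * \<bar>u i\<bar>)
          + (\<Sum>i=1..n. (C\<^sub>u * \<bar>v i\<bar> + C\<^sub>v * \<bar>u i\<bar>) * ?w i)"
      by (simp only: distrib_left sum.distrib mult_1_right)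
    then show ?thesis
      unfolding decay_const_def by (simp only:) (simp only: algebra_simps)
  qed
  finally show ?thesis .
qed

section \<open>Unconditional sums over pairs and their regrouping\<close>

lemma has_sum_of_abs_summable:
  fixes f :: "nat \<Rightarrow> real"
  assumes "summable (\<lambda>i. \<bar>f i\<bar>)"
  shows "(f has_sum suminf f) UNIV"
  using norm_summable_imp_has_sum[of f "suminf f"] assms summable_rabs_cancel[OF assms]
  by (simp add: summable_sums)

text \<open>Summing the norms first over \<open>j\<close> leaves a constant multiple of
  \<open>\<bar>a i\<bar>\<close>, which is summable in \<open>i\<close>.\<close>

lemma abs_product_summable_on:
  fixes a b :: "nat \<Rightarrow> real"
  assumes a: "summable (\<lambda>i. \<bar>a i\<bar>)" and b: "summable (\<lambda>i. \<bar>b i\<bar>)"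
  shows "(\<lambda>(i, j). \<bar>a i * b j\<bar>) summable_on UNIV"
proof -
  have a': "(\<lambda>i. \<bar>a i\<bar>) summable_on UNIV" and b': "(\<lambda>j. \<bar>b j\<bar>) summable_on UNIV"
    using norm_summable_imp_summable_on[of "\<lambda>i. \<bar>a i\<bar>"] norm_summable_imp_summable_on[of "\<lambda>i. \<bar>b i\<bar>"] a b
    by simp_all
  have "(\<lambda>p. norm (a (fst p) * b (snd p))) summable_on (UNIV \<times> UNIV)"
  proof (subst abs_summable_on_Sigma_iff, intro conjI ballI)
    show "(\<lambda>j. norm (a (fst (i, j)) * b (snd (i, j)))) summable_on UNIV" for i
      using summable_on_cmult_right[OF b', of "\<bar>a i\<bar>"] by (simp add: abs_mult)
    have "(\<lambda>i. \<bar>a i\<bar> * \<bar>\<Sum>\<^sub>\<infinity>j. \<bar>b j\<bar>\<bar>) summable_on UNIV"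
      by (rule summable_on_cmult_left[OF a'])
    then show "(\<lambda>i. norm (\<Sum>\<^sub>\<infinity>j. norm (a (fst (i, j)) * b (snd (i, j))))) summable_on UNIV"
      by (simp add: abs_mult infsum_cmult_right')
  qed
  then show ?thesis by (simp add: case_prod_unfold)
qed

lemma has_sum_product_real:
  fixes a b :: "nat \<Rightarrow> real"
  assumes a: "summable (\<lambda>i. \<bar>a i\<bar>)" and b: "summable (\<lambda>i. \<bar>b i\<bar>)"
  shows "((\<lambda>(i, j). a i * b j) has_sum (suminf a * suminf b)) UNIV"
proof -
  have "(\<lambda>(i, j). a i * b j) summable_on (UNIV \<times> UNIV)"
    using abs_summable_summable[of "\<lambda>(i, j). a i * b j" UNIV] abs_product_summable_on[OF a b]
    by (simp add: case_prod_unfold)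
  then have "((\<lambda>(i, j). a i * b j) has_sum (suminf a * suminf b)) (UNIV \<times> UNIV)"
  proof (rule has_sum_SigmaI[rotated 2])
    show "((\<lambda>j. case (i, j) of (i, j) \<Rightarrow> a i * b j) has_sum (a i * suminf b)) UNIV" for i
      using has_sum_cmult_right[OF has_sum_of_abs_summable[OF b], of "a i"] by simp
    show "((\<lambda>i. a i * suminf b) has_sum (suminf a * suminf b)) UNIV"
      by (rule has_sum_cmult_left[OF has_sum_of_abs_summable[OF a]])
  qed
  then show ?thesis by simp
qed

text \<open>An unconditional sum survives a bijective reindexing and may then be summed fibre by
  fibre. The fibres are the finite antidiagonals \<open>i + j = k\<close> in the first claim and the
  diagonals \<open>j - i = k + 1\<close> in the second, where \<open>Suc\<close> encodes
  \<open>i < j\<close>.\<close>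

lemma sums_diagonals:
  fixes h :: "nat \<Rightarrow> nat \<Rightarrow> real"
  assumes "(\<lambda>(i, j). \<bar>h i j\<bar>) summable_on UNIV"
  shows "((\<lambda>(i, j). h i j) has_sum S) UNIV \<Longrightarrow> (\<lambda>k. \<Sum>i\<le>k. h i (k - i)) sums S"
    and "((\<lambda>(i, j). h i j) has_sum S) {(i, j). i < j} \<Longrightarrow> (\<lambda>k. \<Sum>i. h i (Suc (i + k))) sums S"
proof -
  assume S: "((\<lambda>(i, j). h i j) has_sum S) UNIV"
  have "((\<lambda>(k, i). h i (k - i)) has_sum S) (SIGMA k:UNIV. {..k})
      \<longleftrightarrow> ((\<lambda>(i, j). h i j) has_sum S) UNIV"
    by (rule has_sum_reindex_bij_witness[of _ "\<lambda>(i, j). (i + j, i)" "\<lambda>(k, i). (i, k - i)"]) auto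
  with S have Sigma: "((\<lambda>(k, i). h i (k - i)) has_sum S) (SIGMA k:UNIV. {..k})" by simp
  have "((\<lambda>k. \<Sum>i\<le>k. h i (k - i)) has_sum S) UNIV"
    by (rule has_sum_SigmaD[OF Sigma]) (simp add: has_sum_finite)
  then show "(\<lambda>k. \<Sum>i\<le>k. h i (k - i)) sums S" by (rule has_sum_imp_sums)
next
  assume S: "((\<lambda>(i, j). h i j) has_sum S) {(i, j). i < j}"
  have abs_sub: "(\<lambda>(i, j). \<bar>h i j\<bar>) summable_on {(i, j). i < j}"
    using assms by (rule summable_on_subset) auto
  have "((\<lambda>(k, i). h i (Suc (i + k))) has_sum S) (UNIV \<times> UNIV)
      \<longleftrightarrow> ((\<lambda>(i, j). h i j) has_sum S) {(i, j). i < j}"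
    by (rule has_sum_reindex_bij_witness[of _ "\<lambda>(i, j). (j - Suc i, i)" "\<lambda>(k, i). (i, Suc (i + k))"]) auto
  with S have Sigma: "((\<lambda>(k, i). h i (Suc (i + k))) has_sum S) (UNIV \<times> UNIV)" by simp
  \<comment> \<open>Each fibre is summable in its own right, so its unconditional sum coincides with
    \<open>suminf\<close>.\<close>
  have "((\<lambda>i. h i (Suc (i + k))) has_sum (\<Sum>i. h i (Suc (i + k)))) UNIV" for k
  proof -
    have "(\<lambda>i. h i (Suc (i + k))) summable_on UNIV"
      using summable_on_SigmaD1[of "\<lambda>k i. h i (Suc (i + k))" UNIV "\<lambda>_. UNIV" k] Sigma
      by (auto simp: summable_on_def)
    then have "((\<lambda>i. h i (Suc (i + k))) has_sum (\<Sum>\<^sub>\<infinity>i. h i (Suc (i + k)))) UNIV"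
      by (rule has_sum_infsum)
    moreover from has_sum_imp_sums[OF this]
    have "(\<Sum>i. h i (Suc (i + k))) = (\<Sum>\<^sub>\<infinity>i. h i (Suc (i + k)))"
      by (simp add: sums_iff)
    ultimately show ?thesis by simp
  qed
  then have "((\<lambda>k. \<Sum>i. h i (Suc (i + k))) has_sum S) UNIV"
    by (intro has_sum_SigmaD[OF Sigma]) simp
  then show "(\<lambda>k. \<Sum>i. h i (Suc (i + k))) sums S" by (rule has_sum_imp_sums)
qed

section \<open>The sine series of the product\<close>

lemma prod_coeff_sums:
  fixes u v :: "nat \<Rightarrow> real" and x :: real
  assumes u: "summable (\<lambda>i. \<bar>u (Suc i)\<bar>)" and v: "summable (\<lambda>i. \<bar>v (Suc i)\<bar>)"
  shows "(\<lambda>k. prod_coeff u v (Suc k) * sin (real (Suc k) * x)) sums (cos_series u x * sin_series v x)"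
proof -
  \<comment> \<open>Indices start at zero, so the entry \<open>(i, j)\<close> belongs to the
    coefficients \<open>i + 1\<close> and \<open>j + 1\<close>. Hence \<open>P\<close> has frequency
    \<open>i + j + 2\<close>, while in \<open>Q\<close> the shifts cancel.\<close>
  define F where "F i j = u (Suc i) * v (Suc j)" for i j
  define P where "P i j = F i j * sin (real (Suc (Suc (i + j))) * x)" for i j
  define Q where "Q i j = F i j * sin ((real j - real i) * x)" for i j
  define a where "a i = u (Suc i) * cos (real (Suc i) * x)" for i
  define b where "b j = v (Suc j) * sin (real (Suc j) * x)" for j
  have a: "summable (\<lambda>i. \<bar>a i\<bar>)"
    by (rule summable_comparison_test'[OF u]) (auto simp: a_def abs_mult mult_left_le)
  have b: "summable (\<lambda>i. \<bar>b i\<bar>)"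
    by (rule summable_comparison_test'[OF v]) (auto simp: b_def abs_mult mult_left_le)
  have F: "(\<lambda>(i, j). \<bar>F i j\<bar>) summable_on UNIV"
    using abs_product_summable_on[OF u v] by (simp add: F_def)
  have dom: "(\<lambda>(i, j). \<bar>F i j * t i j\<bar>) summable_on UNIV" if "\<And>i j. \<bar>t i j\<bar> \<le> 1" for t
    using abs_summable_on_comparison_test'[OF F, of "\<lambda>(i, j). F i j * t i j"] that
    by (auto simp: abs_mult mult_left_le case_prod_unfold)
  have P_abs: "(\<lambda>(i, j). \<bar>P i j\<bar>) summable_on UNIV"
    and Q_abs: "(\<lambda>(i, j). \<bar>Q i j\<bar>) summable_on UNIV"
    unfolding P_def Q_def by (rule dom, simp)+
  have Q_abs': "(\<lambda>(i, j). \<bar>Q j i\<bar>) summable_on UNIV"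
  proof -
    have "(\<lambda>(i, j). \<bar>Q j i\<bar>) summable_on UNIV \<longleftrightarrow> (\<lambda>(i, j). \<bar>Q i j\<bar>) summable_on UNIV"
      by (rule summable_on_reindex_bij_witness[of _ prod.swap prod.swap]) auto
    with Q_abs show ?thesis by simp
  qed
  obtain SP where SP: "((\<lambda>(i, j). P i j) has_sum SP) UNIV"
    using abs_summable_summable[of "\<lambda>(i, j). P i j" UNIV] P_abs
    by (auto simp: case_prod_unfold summable_on_def)
  have Q_on: "(\<lambda>(i, j). Q i j) summable_on A" for A
    using abs_summable_summable[of "\<lambda>(i, j). Q i j" UNIV] Q_abs
    by (auto simp: case_prod_unfold intro: summable_on_subset)
  obtain S1 where S1: "((\<lambda>(i, j). Q i j) has_sum S1) {(i, j). i < j}"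
    using Q_on by (auto simp: summable_on_def)
  obtain S2 where S2: "((\<lambda>(i, j). Q i j) has_sum S2) {(i, j). j < i}"
    using Q_on by (auto simp: summable_on_def)
  have "((\<lambda>(i, j). Q i j) has_sum (S1 + S2)) ({(i, j). i < j} \<union> {(i, j). j < i})"
    by (rule has_sum_Un_disjoint[OF S1 S2]) auto
  \<comment> \<open>The missing diagonal \<open>i = j\<close> contributes nothing, because there the
    sine is taken at zero.\<close>
  also have "?this \<longleftrightarrow> ((\<lambda>(i, j). Q i j) has_sum (S1 + S2)) UNIV"
    by (rule has_sum_cong_neutral) (auto simp: Q_def not_less)
  finally have SQ: "((\<lambda>(i, j). Q i j) has_sum (S1 + S2)) UNIV" .
  have "((\<lambda>p. 1/2 * ((\<lambda>(i, j). P i j) p + (\<lambda>(i, j). Q i j) p)) has_sum (1/2 * (SP + (S1 + S2)))) UNIV"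
    by (intro has_sum_cmult_right has_sum_add SP SQ)
  also have "(\<lambda>p. 1/2 * ((\<lambda>(i, j). P i j) p + (\<lambda>(i, j). Q i j) p)) = (\<lambda>(i, j). a i * b j)"
  proof (rule ext, clarify)
    fix i j
    let ?y = "real (Suc i) * x" and ?z = "real (Suc j) * x"
    \<comment> \<open>Sum and difference of the angles, ready for
      \<open>2 cos y sin z = sin (z + y) + sin (z - y)\<close>.\<close>
    have "real (Suc (Suc (i + j))) * x = ?z + ?y" "(real j - real i) * x = ?z - ?y"
      by (simp_all add: algebra_simps)
    then show "1/2 * (P i j + Q i j) = a i * b j"
      by (simp only: P_def Q_def F_def a_def b_def sin_add sin_diff) (simp add: algebra_simps)
  qed
  finally have ab: "suminf a * suminf b = 1/2 * (SP + (S1 + S2))"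
    using has_sum_product_real[OF a b] has_sum_unique by blast
  have "(\<lambda>k. \<Sum>i\<le>k. P i (k - i)) sums SP"
    by (rule sums_diagonals(1)[OF P_abs SP])
  \<comment> \<open>Antidiagonal \<open>k\<close> carries frequency \<open>k + 2\<close>. Prepending
    a zero aligns term \<open>k\<close> with frequency \<open>k + 1\<close>; the zero is the empty
    convolution in the first coefficient.\<close>
  then have sumP: "(\<lambda>k. if k = 0 then 0 else \<Sum>i\<le>k-1. P i (k - 1 - i)) sums SP"
    using sums_Suc[of "\<lambda>k. if k = 0 then 0 else \<Sum>i\<le>k-1. P i (k - 1 - i)" SP] by simp
  have P_coeff: "(if k = 0 then 0 else \<Sum>i\<le>k-1. P i (k - 1 - i))
      = (\<Sum>i=1..k. u i * v (Suc k - i)) * sin (real (Suc k) * x)" for k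
  proof (cases k)
    case (Suc m)
    have "(\<Sum>i\<le>m. P i (m - i)) = (\<Sum>i\<le>m. u (Suc i) * v (Suc (m - i)) * sin (real (Suc k) * x))"
      by (rule sum.cong) (auto simp: P_def F_def Suc)
    also have "\<dots> = (\<Sum>i\<le>m. u (Suc i) * v (Suc (m - i))) * sin (real (Suc k) * x)"
      by (simp add: sum_distrib_right)
    also have "(\<Sum>i\<le>m. u (Suc i) * v (Suc (m - i))) = (\<Sum>i=1..k. u i * v (Suc k - i))"
      by (rule sum.reindex_bij_witness[of _ "\<lambda>i. i - 1" Suc]) (auto simp: Suc Suc_diff_le)
    finally show ?thesis by (simp add: Suc)
  qed simp
  have sum1: "(\<lambda>k. \<Sum>i. Q i (Suc (i + k))) sums S1"
    by (rule sums_diagonals(2)[OF Q_abs S1])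
  have summ: "summable (\<lambda>i. u (Suc i) * v (Suc i + k))" "summable (\<lambda>i. u (Suc i + k) * v (Suc i))" for k
    using summable_abs_mult_shift[OF u v, of k] summable_abs_mult_shift[OF v u, of k]
    by (auto intro: summable_rabs_cancel simp: mult.commute)
  \<comment> \<open>The sine is constant along a diagonal and leaves the series as a factor.\<close>
  have Q1: "(\<Sum>i. Q i (Suc (i + k))) = (\<Sum>i. u (Suc i) * v (Suc i + Suc k)) * sin (real (Suc k) * x)" for k
    using suminf_mult2[OF summ(1)[of "Suc k"], of "sin (real (Suc k) * x)"]
    by (simp add: Q_def F_def)
  \<comment> \<open>The lower triangle is reflected into the upper one; oddness of the sine then
    yields the minus sign in \<open>prod_coeff\<close>.\<close>
  have "((\<lambda>(i, j). Q j i) has_sum S2) {(i, j). i < j} \<longleftrightarrow> ((\<lambda>(i, j). Q i j) has_sum S2) {(i, j). j < i}"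
    by (rule has_sum_reindex_bij_witness[of _ prod.swap prod.swap]) auto
  with S2 have "(\<lambda>k. \<Sum>i. Q (Suc (i + k)) i) sums S2"
    using sums_diagonals(2)[OF Q_abs'] by simp
  moreover have Q2: "(\<Sum>i. Q (Suc (i + k)) i)
      = - (\<Sum>i. u (Suc i + Suc k) * v (Suc i)) * sin (real (Suc k) * x)" for k
  proof -
    have "Q (Suc (i + k)) i = (u (Suc i + Suc k) * v (Suc i)) * - sin (real (Suc k) * x)" for i
    proof -
      have "(real i - real (Suc (i + k))) * x = - (real (Suc k) * x)"
        by (simp add: algebra_simps)
      then have "sin ((real i - real (Suc (i + k))) * x) = - sin (real (Suc k) * x)"
        by (simp only: sin_minus)
      then show ?thesis unfolding Q_def F_def by simp
    qed
    then show ?thesis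
      using suminf_mult2[OF summ(2)[of "Suc k"], of "- sin (real (Suc k) * x)"] by simp
  qed
  ultimately have sum2: "(\<lambda>k. - (\<Sum>i. u (Suc i + Suc k) * v (Suc i)) * sin (real (Suc k) * x)) sums S2"
    by simp
  have sum0: "(\<lambda>k. u 0 * b k) sums (u 0 * suminf b)"
    using summable_rabs_cancel[OF b] by (intro sums_mult summable_sums)
  have "(\<lambda>k. u 0 * b k + 1/2 * ((\<Sum>i=1..k. u i * v (Suc k - i)) * sin (real (Suc k) * x)
        + ((\<Sum>i. u (Suc i) * v (Suc i + Suc k)) * sin (real (Suc k) * x)
           + - (\<Sum>i. u (Suc i + Suc k) * v (Suc i)) * sin (real (Suc k) * x))))
      sums (u 0 * suminf b + 1/2 * (SP + (S1 + S2)))"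
    using sumP sum1 sum2 unfolding P_coeff Q1 by (intro sums_add sums_mult sum0)
  also have "u 0 * suminf b + 1/2 * (SP + (S1 + S2)) = cos_series u x * sin_series v x"
    unfolding ab[symmetric] cos_series_def sin_series_def a_def b_def by (simp add: algebra_simps)
  finally show ?thesis
    unfolding prod_coeff_def b_def by (rule sums_cong[THEN iffD1, rotated]) (simp add: algebra_simps)
qed

section \<open>Interval membership and the complete statement\<close>

lemma mem_pm_intervalI:
  assumes "\<bar>y - a\<bar> \<le> c" "c > 0"
  shows "y \<in> pm_interval a c"
proof -
  have "y = a + c * ((y - a) / c)" "(y - a) / c \<in> {-1..1}"
    using assms by (auto simp: abs_le_iff field_simps)
  then show ?thesis unfolding pm_interval_def by blast
qed

text \<open>The summability claims make the \<open>suminf\<close> terms in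
  \<open>cos_series\<close>, \<open>sin_series\<close> and \<open>prod_coeff\<close> genuine sums,
  since \<open>suminf\<close> has no specified value on a divergent series.\<close>

theorem lemma5p2:
  fixes u v :: "nat \<Rightarrow> real" and n :: nat and s C\<^sub>u C\<^sub>v :: real
  assumes "n \<ge> 1" and "s > 1" and "C\<^sub>u > 0" and "C\<^sub>v > 0"
    and "\<And>i. i > n \<Longrightarrow> u i \<in> {- (C\<^sub>u / real i powr s) .. C\<^sub>u / real i powr s}"
    and "\<And>i. i > n \<Longrightarrow> v i \<in> {- (C\<^sub>v / real i powr s) .. C\<^sub>v / real i powr s}"
  shows
    "(\<forall>x. summable (\<lambda>i. u (Suc i) * cos (real (Suc i) * x)))
     \<and> (\<forall>x. summable (\<lambda>i. v (Suc i) * sin (real (Suc i) * x)))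
     \<and> (\<forall>k\<ge>1. summable (\<lambda>i. u (Suc i) * v (Suc i + k))
             \<and> summable (\<lambda>i. u (Suc i + k) * v (Suc i)))
     \<and> (\<forall>x. (\<lambda>k. prod_coeff u v (Suc k) * sin (real (Suc k) * x))
             sums (cos_series u x * sin_series v x))
     \<and> (\<forall>k. 1 \<le> k \<and> k \<le> 2 * n \<longrightarrow>
          prod_coeff u v k \<in> pm_interval
            (u 0 * v k + 1/2 * ((\<Sum>i=1..n. v (i + k) * u i) - (\<Sum>i=1..n. v i * u (k + i))
                                + (\<Sum>i=1..k-1. v i * u (k - i))))
            (C\<^sub>u * C\<^sub>v * (real n powr (1 - 2 * s) / (2 * s - 1))))
     \<and> (\<forall>k>2 * n.
          prod_coeff u v k \<in>
            {- (decay_const u v n s C\<^sub>u C\<^sub>v / real k powr s) ..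
             decay_const u v n s C\<^sub>u C\<^sub>v / real k powr s})"
proof (intro conjI allI impI)
  \<comment> \<open>Interval membership becomes an absolute bound with exponent \<open>- s\<close>,
    the form used by all the estimates.\<close>
  have u: "\<bar>u i\<bar> \<le> C\<^sub>u * real i powr (- s)" if "i > n" for i
    using assms(5)[OF that] by (auto simp: powr_minus_divide abs_le_iff)
  have v: "\<bar>v i\<bar> \<le> C\<^sub>v * real i powr (- s)" if "i > n" for i
    using assms(6)[OF that] by (auto simp: powr_minus_divide abs_le_iff)
  have su: "summable (\<lambda>i. \<bar>u (Suc i)\<bar>)" and sv: "summable (\<lambda>i. \<bar>v (Suc i)\<bar>)"
    using abs_summable_Suc_of_decay[OF assms(2) u] abs_summable_Suc_of_decay[OF assms(2) v] by auto
  show "summable (\<lambda>i. u (Suc i) * cos (real (Suc i) * x))" for x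
    by (rule summable_comparison_test'[OF su]) (auto simp: abs_mult mult_left_le)
  show "summable (\<lambda>i. v (Suc i) * sin (real (Suc i) * x))" for x
    by (rule summable_comparison_test'[OF sv]) (auto simp: abs_mult mult_left_le)
  show "summable (\<lambda>i. u (Suc i) * v (Suc i + k))" for k
    using summable_rabs_cancel[OF summable_abs_mult_shift[OF su sv, of k]] by simp
  show "summable (\<lambda>i. u (Suc i + k) * v (Suc i))" for k
    using summable_rabs_cancel[OF summable_abs_mult_shift[OF sv su, of k]] by (simp add: mult.commute)
  show "(\<lambda>k. prod_coeff u v (Suc k) * sin (real (Suc k) * x))
      sums (cos_series u x * sin_series v x)" for x
    by (rule prod_coeff_sums[OF su sv])
  show "prod_coeff u v k \<in> pm_interval
            (u 0 * v k + 1/2 * ((\<Sum>i=1..n. v (i + k) * u i) - (\<Sum>i=1..n. v i * u (k + i))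
                                + (\<Sum>i=1..k-1. v i * u (k - i))))
            (C\<^sub>u * C\<^sub>v * (real n powr (1 - 2 * s) / (2 * s - 1)))" for k
    using prod_coeff_low[OF assms(1-4) u v, of k] assms(1-4)
    by (intro mem_pm_intervalI) auto
  show "prod_coeff u v k \<in> {- (decay_const u v n s C\<^sub>u C\<^sub>v / real k powr s) ..
             decay_const u v n s C\<^sub>u C\<^sub>v / real k powr s}" if "2 * n < k" for k
    using prod_coeff_high[OF assms(1-4) that u v] by (auto simp: powr_minus_divide abs_le_iff)
qed

end
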